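(* Let $\mathcal C$ be the 7-qubit XP stabilizer code of precision $N=8$ whose stabilizer group is generated by the six operators $XP_8(\mathbf x|\mathbf z|p)$ with $(\mathbf x|\mathbf z|p)$ equal to $$(1,0,1,0,1,0,1\,|\,0,0,2,0,0,4,6\,|\,0),\quad(0,1,1,0,0,1,1\,|\,0,3,6,0,4,3,2\,|\,2),\quad(0,0,0,1,1,1,1\,|\,0,0,0,2,0,7,2\,|\,13),$$ $$(0,0,0,0,0,0,0\,|\,4,0,4,0,4,0,4\,|\,0),\quad(0,0,0,0,0,0,0\,|\,0,4,4,0,0,4,4\,|\,0),\quad(0,0,0,0,0,0,0\,|\,0,0,0,4,4,4,4\,|\,0).$$ Then $\mathcal C$ is a $[[7,1,3]]$ code (i.e. $\dim\mathcal C=2$ and its distance is $3$), and $\mathcal C$ is not local-unitary equivalent to the $[[7,1,3]]$ Steane code.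
   Context: For $N=8$ let $\omega=e^{i\pi/8}$, $P=\mathrm{diag}(1,\omega^2)$, and for $\mathbf x\in\mathbb Z_2^7$, $\mathbf z\in\mathbb Z_8^7$, $p\in\mathbb Z_{16}$ let $XP_8(\mathbf x|\mathbf z|p)=\omega^p\bigotimes_iX^{\mathbf x[i]}P^{\mathbf z[i]}$. The code stabilized by a group $\mathcal S$ of such operators is $\{|\psi\rangle:g|\psi\rangle=|\psi\rangle\ \forall g\in\mathcal S\}$. The distance of a code with projector $\Pi$ is the smallest weight (number of non-identity tensor factors) of a Pauli string $E\in\{I,X,Y,Z\}^{\otimes n}$ for which $\Pi E\Pi$ is not proportional to $\Pi$. Two $n$-qubit codes with projectors $\Pi,\Pi'$ are local-unitary (LU) equivalent if $\Pi'=U\Pi U^\dagger$ for some $U=U_1\otimes\cdots\otimes U_n$ with single-qubit unitaries $U_i$. The Steane code is the Pauli stabilizer code with generators $X^{\mathbf h}$ and $Z^{\mathbf h}$ for $\mathbf h\in\{1010101,\,0110011,\,0001111\}$. *)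

theory Defs
  imports "HOL-Analysis.Analysis" "HOL-Algebra.Generated_Groups"
begin

section \<open>Qubits and operators\<close>

text \<open>
  The qubits are indexed by a finite type \<open>'n\<close>.  The computational basis of a single qubit is
  indexed by \<^typ>\<open>bool\<close> (\<^term>\<open>False\<close> for \<open>|0>\<close>, \<^term>\<open>True\<close> for \<open>|1>\<close>), that of the
  whole system by \<^typ>\<open>'n \<Rightarrow> bool\<close>.
\<close>

type_synonym qubit_op = "complex ^ bool ^ bool"
type_synonym 'n op = "complex ^ ('n \<Rightarrow> bool) ^ ('n \<Rightarrow> bool)"
type_synonym 'n state = "complex ^ ('n \<Rightarrow> bool)"

definition tensor_op :: "('n::finite \<Rightarrow> qubit_op) \<Rightarrow> 'n op" where
  "tensor_op A = (\<chi> a b. \<Prod>i\<in>UNIV. A i $ a i $ b i)"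

definition dagger :: "complex ^ 'a ^ 'b \<Rightarrow> complex ^ 'b ^ 'a" where
  "dagger A = (\<chi> i j. cnj (A $ j $ i))"

definition unitary :: "complex ^ 'a ^ 'a \<Rightarrow> bool" where
  "unitary U \<longleftrightarrow> dagger U ** U = mat 1 \<and> U ** dagger U = mat 1"

text \<open>The power operation \<open>^\<close> is not used for matrices since \<open>*\<close> is componentwise on them.\<close>

primrec mat_pow :: "complex ^ 'a ^ 'a \<Rightarrow> nat \<Rightarrow> complex ^ 'a ^ 'a" where
  "mat_pow A 0 = mat 1"
| "mat_pow A (Suc k) = A ** mat_pow A k"

definition qubit_mat :: "complex \<Rightarrow> complex \<Rightarrow> complex \<Rightarrow> complex \<Rightarrow> qubit_op" where
  "qubit_mat a b c d = (\<chi> i j. if i then (if j then d else c) else (if j then b else a))"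

datatype pauli = PauliI | PauliX | PauliY | PauliZ

fun pauli_mat :: "pauli \<Rightarrow> qubit_op" where
  "pauli_mat PauliI = mat 1"
| "pauli_mat PauliX = qubit_mat 0 1 1 0"
| "pauli_mat PauliY = qubit_mat 0 (- \<i>) \<i> 0"
| "pauli_mat PauliZ = qubit_mat 1 0 0 (-1)"

definition pauli_string :: "('n::finite \<Rightarrow> pauli) \<Rightarrow> 'n op" where
  "pauli_string E = tensor_op (\<lambda>i. pauli_mat (E i))"

definition pauli_weight :: "('n::finite \<Rightarrow> pauli) \<Rightarrow> nat" where
  "pauli_weight E = card {i. E i \<noteq> PauliI}"


section \<open>Codes\<close>

definition unitary_group :: "(complex ^ 'a ^ 'a) monoid" where
  "unitary_group = \<lparr>carrier = {U. unitary U}, mult = (**), one = mat 1\<rparr>"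

definition stabilized_code :: "'n::finite op set \<Rightarrow> 'n state set" where
  "stabilized_code S = {\<psi>. \<forall>g\<in>S. g *v \<psi> = \<psi>}"

definition is_projector_onto :: "'n::finite op \<Rightarrow> 'n state set \<Rightarrow> bool" where
  "is_projector_onto Q C \<longleftrightarrow> Q ** Q = Q \<and> dagger Q = Q \<and> range ((*v) Q) = C"

lemma ex1_projector_onto:
  fixes C :: "'n::finite state set"
  assumes C: "vec.subspace C"
  shows "\<exists>!Q. is_projector_onto Q C"
proof (rule ex_ex1I)
  have sub: "subspace C"
  proof (rule subspaceI)
    show "0 \<in> C" by (rule vec.subspace_0[OF C])
    show "x + y \<in> C" if "x \<in> C" "y \<in> C" for x y by (rule vec.subspace_add[OF C that])
    show "c *\<^sub>R x \<in> C" if "x \<in> C" for c x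
    proof -
      have "c *\<^sub>R x = complex_of_real c *s x" by (subst vec_eq_iff) (metis scaleR_conv_of_real vector_scaleR_component vector_smult_component)
      then show ?thesis using vec.subspace_scale[OF C that] by simp
    qed
  qed
  have inn: "inner w (c *s v) = inner (cnj c *s w) v" for w v :: "'n state" and c
    by (simp add: inner_vec_def inner_complex_def algebra_simps)
  have ex: "\<exists>!y. y \<in> C \<and> (\<forall>w\<in>C. inner w (x - y) = 0)" for x
  proof (rule ex_ex1I)
    obtain y z where "y \<in> span C" "\<And>w. w \<in> span C \<Longrightarrow> orthogonal z w" "x = y + z"
      using orthogonal_subspace_decomp_exists[of C x] by metis
    then show "\<exists>y. y \<in> C \<and> (\<forall>w\<in>C. inner w (x - y) = 0)"
      using span_eq_iff[THEN iffD2, OF sub] orthogonal_def[of z] inner_commute[of z]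
      by (intro exI[of _ y]) simp
  next
    fix y y' assume a: "y \<in> C \<and> (\<forall>w\<in>C. inner w (x - y) = 0)" "y' \<in> C \<and> (\<forall>w\<in>C. inner w (x - y') = 0)"
    then have "y - y' \<in> C" using sub subspace_diff by blast
    with a have "inner (y - y') (x - y') = 0" "inner (y - y') (x - y) = 0" by auto
    then have "inner (y - y') (y - y') = 0" by (simp add: inner_diff_right)
    then show "y = y'" by simp
  qed
  define f where "f x = (THE y. y \<in> C \<and> (\<forall>w\<in>C. inner w (x - y) = 0))" for x
  have f1: "f x \<in> C" and f2: "\<And>w. w \<in> C \<Longrightarrow> inner w (x - f x) = 0" for x
    using theI'[OF ex[of x]] unfolding f_def by auto
  have f3: "f x = y" if "y \<in> C" "\<And>w. w \<in> C \<Longrightarrow> inner w (x - y) = 0" for x y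
    using ex[of x] f1 f2 that by blast
  have lin: "Vector_Spaces.linear (*s) (*s) f"
  proof (rule Vector_Spaces.linear_iff[THEN iffD2], intro conjI allI vec.vector_space_axioms)
    show "f (x + y) = f x + f y" for x y
    proof (rule f3)
      show "f x + f y \<in> C" using f1 vec.subspace_add[OF C] by blast
      show "inner w (x + y - (f x + f y)) = 0" if "w \<in> C" for w
        using f2[OF that, of x] f2[OF that, of y] by (simp add: inner_diff_right inner_add_right)
    qed
    show "f (c *s x) = c *s f x" for c x
    proof (rule f3)
      show "c *s f x \<in> C" using f1 vec.subspace_scale[OF C] by auto
      show "inner w (c *s x - c *s f x) = 0" if "w \<in> C" for w
        using f2[OF vec.subspace_scale[OF C that], of "cnj c" x] inn[of w c "x - f x"]
        by (simp only: vec.scale_right_diff_distrib)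
    qed
  qed
  let ?A = "matrix f"
  have A: "?A *v x = f x" for x using matrix_works[OF lin] .
  have ff: "f x = x" if "x \<in> C" for x by (rule f3) (use that in simp_all)
  have idem: "?A ** ?A = ?A"
    by (subst matrix_eq) (simp only: matrix_vector_mul_assoc[symmetric] A ff[OF f1] simp_thms)
  have sa: "inner (f x) y = inner x (f y)" for x y
    using f2[OF f1, of x y] f2[OF f1, of y x] inner_commute[of x "f y"] inner_commute[of "f x" "f y"]
    unfolding inner_diff_right by linarith
  have cs: "f (c *s x) = c *s f x" for c x using lin unfolding Vector_Spaces.linear_iff by blast
  have ent: "?A $ i $ j = f (axis j 1) $ i" for i j by (simp add: matrix_def)
  have ax: "axis i c = c *s axis i (1::complex)" for i :: "'n \<Rightarrow> bool" and c
    by (subst vec_eq_iff) (simp add: axis_def vector_smult_component)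
  have "inner (f (axis j 1)) (axis i c) = inner (axis j 1) (c *s f (axis i 1))" for i j c
    using sa[of "axis j 1" "axis i c"] by (simp only: ax[of i c] cs)
  then have "inner (?A $ i $ j) c = inner 1 (c * ?A $ j $ i)" for i j c
    by (simp only: ent inner_axis inner_axis' vector_smult_component)
  then have entries: "inner (?A $ i $ j) c = inner 1 (c * ?A $ j $ i)" for i j c .
  have "cnj (?A $ j $ i) = ?A $ i $ j" for i j
    using entries[of i j 1] entries[of i j \<i>] by (simp add: inner_complex_def complex_eq_iff)
  then have "dagger ?A = ?A" unfolding dagger_def by (simp add: vec_eq_iff)
  moreover have "range ((*v) ?A) = C"
  proof
    show "range ((*v) ?A) \<subseteq> C" using f1 A by auto
    show "C \<subseteq> range ((*v) ?A)" using ff A by (metis rangeI subsetI)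
  qed
  ultimately show "\<exists>Q. is_projector_onto Q C" using idem unfolding is_projector_onto_def by blast
next
  fix Q R assume a: "is_projector_onto Q C" "is_projector_onto R C"
  have dm: "dagger (A ** B) = dagger B ** dagger A" for A B :: "'n op"
    by (simp add: dagger_def vec_eq_iff matrix_matrix_mult_def mult.commute)
  have *: "Q ** R = R" if "is_projector_onto Q C" "is_projector_onto R C" for Q R :: "'n op"
  proof (subst matrix_eq, intro allI)
    fix x have "R *v x \<in> range ((*v) Q)" using that unfolding is_projector_onto_def by auto
    then obtain y where "R *v x = Q *v y" by auto
    then show "(Q ** R) *v x = R *v x" using that unfolding is_projector_onto_def
      by (metis matrix_vector_mul_assoc)
  qed
  have "Q = dagger (R ** Q)" using *[OF a(2,1)] a by (simp add: is_projector_onto_def)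
  also have "\<dots> = Q ** R" using a by (simp add: dm is_projector_onto_def)
  finally show "Q = R" using *[OF a] by simp
qed

lemma subspace_stabilized_code: "vec.subspace (stabilized_code S)"
  unfolding vec.subspace_def stabilized_code_def
  by (simp add: matrix_vector_right_distrib vec.scale)

definition code_projector :: "'n::finite state set \<Rightarrow> 'n op" where
  "code_projector C = (THE Q. is_projector_onto Q C)"

definition code_distance :: "'n::finite state set \<Rightarrow> nat" where
  "code_distance C = (let Q = code_projector C in
     LEAST w. \<exists>E. pauli_weight E = w \<and> \<not> (\<exists>c. Q ** pauli_string E ** Q = mat c ** Q))"

definition LU_equivalent :: "'n::finite state set \<Rightarrow> 'n state set \<Rightarrow> bool" where
  "LU_equivalent C C' \<longleftrightarrow> (\<exists>U. (\<forall>i. unitary (U i)) \<and>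
     code_projector C' = tensor_op U ** code_projector C ** dagger (tensor_op U))"


section \<open>XP operators of precision 8\<close>

definition omega :: complex where
  "omega = exp (\<i> * complex_of_real pi / 8)"

definition P_mat :: qubit_op where
  "P_mat = qubit_mat 1 0 0 (omega ^ 2)"

text \<open>
  Elements of \<open>\<int>\<^sub>2\<close>, \<open>\<int>\<^sub>8\<close> and \<open>\<int>\<^sub>1\<^sub>6\<close> are given by natural number representatives; the
  operator does not depend on their choice as \<open>X\<^sup>2 = 1\<close>, \<open>P\<^sup>8 = 1\<close> and \<open>\<omega>\<^sup>1\<^sup>6 = 1\<close>.
\<close>

definition XP8 :: "nat ^ 'n \<Rightarrow> nat ^ 'n \<Rightarrow> nat \<Rightarrow> 'n::finite op" where
  "XP8 x z p = mat (omega ^ p) **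
     tensor_op (\<lambda>i. mat_pow (pauli_mat PauliX) (x $ i) ** mat_pow P_mat (z $ i))"


section \<open>The two seven-qubit codes\<close>

text \<open>
  The index type \<open>7\<close> has the elements \<open>1, \<dots>, 6\<close> and \<open>7 = 0\<close>;
  \<^const>\<open>vector\<close> places the entries of a list at \<open>1, \<dots>, 7\<close> in this order.
\<close>

definition XP_generators :: "7 op set" where
  "XP_generators =
    {XP8 (vector [1,0,1,0,1,0,1]) (vector [0,0,2,0,0,4,6]) 0,
     XP8 (vector [0,1,1,0,0,1,1]) (vector [0,3,6,0,4,3,2]) 2,
     XP8 (vector [0,0,0,1,1,1,1]) (vector [0,0,0,2,0,7,2]) 13,
     XP8 (vector [0,0,0,0,0,0,0]) (vector [4,0,4,0,4,0,4]) 0,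
     XP8 (vector [0,0,0,0,0,0,0]) (vector [0,4,4,0,0,4,4]) 0,
     XP8 (vector [0,0,0,0,0,0,0]) (vector [0,0,0,4,4,4,4]) 0}"

definition XP_code :: "7 state set" where
  "XP_code = stabilized_code (generate unitary_group XP_generators)"

definition pauli_power :: "pauli \<Rightarrow> nat ^ 'n \<Rightarrow> 'n::finite op" where
  "pauli_power A h = tensor_op (\<lambda>i. mat_pow (pauli_mat A) (h $ i))"

definition Steane_generators :: "7 op set" where
  "Steane_generators =
    (\<Union>h\<in>{vector [1,0,1,0,1,0,1], vector [0,1,1,0,0,1,1], vector [0,0,0,1,1,1,1]}.
       {pauli_power PauliX h, pauli_power PauliZ h})"

definition Steane_code :: "7 state set" where
  "Steane_code = stabilized_code (generate unitary_group Steane_generators)"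

end

theory Submission
  imports Defs
begin

text \<open>
  A state in the code vanishes outside the Hamming code, and the three generators with an
  \<open>X\<close>-part relate its values along translates by the simplex code, so it is determined by its
  values at the two constant words.  A Pauli error of weight 1 or 2 cannot map a Hamming word to
  another one, and some row of the check matrix contains exactly one qubit of its support; shifting
  by that row changes the sign of every diagonal matrix element, so the compressed error vanishes.

  The Steane code is fixed by \<open>X\<close> and by \<open>Z\<close> on the qubits 1, 3, 4, 6.  A local unitary from the XP
  code onto it would conjugate these to local operators \<open>A\<close>, \<open>B\<close> fixing the XP code.  There
  the terms \<open>|0000>\<close> and \<open>|1111>\<close> of these four qubits occur with two different relative phases, depending on
  the other three qubits, so \<open>A\<close> and \<open>B\<close> fix \<open>|0000>\<close> itself.  Hence their factors on qubit 1 are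
  invertible upper triangular matrices, and those cannot anticommute.
\<close>

section \<open>Linear algebra\<close>

lemma mat_matrix_mult_nth [simp]: "(mat c ** A) $ i $ j = c * A $ i $ j"
  for A :: "'a::semiring_1 ^ 'n ^ 'm"
  by (simp add: matrix_matrix_mult_def mat_def if_distrib if_distribR cong: if_cong)

lemma dagger_mult: "dagger (A ** B) = dagger B ** dagger A"
  by (simp add: dagger_def vec_eq_iff matrix_matrix_mult_def mult.commute)

lemma dagger_mat [simp]: "dagger (mat c) = mat (cnj c)"
  by (auto simp: dagger_def mat_def vec_eq_iff)

lemma unitary_mult: "unitary A \<Longrightarrow> unitary B \<Longrightarrow> unitary (A ** B)"
  unfolding unitary_def dagger_mult
  by (metis matrix_mul_assoc matrix_mul_rid)

lemma unitary_mat: "c * cnj c = 1 \<Longrightarrow> unitary (mat c)"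
  by (simp add: unitary_def vec_eq_iff) (simp add: mat_def mult.commute)

lemma unitary_mat_pow: "unitary A \<Longrightarrow> unitary (mat_pow A n)"
  by (induction n) (auto intro: unitary_mult unitary_mat)

text \<open>A product over qubits of sums over bits expands into a sum over all bit assignments,
  which is the matrix product in the full space.\<close>

lemma tensor_op_mult: "tensor_op A ** tensor_op B = tensor_op (\<lambda>i. A i ** B i)"
proof -
  have "(\<Sum>c\<in>UNIV. (\<Prod>i\<in>UNIV. A i $ a i $ c i) * (\<Prod>i\<in>UNIV. B i $ c i $ b i))
      = (\<Prod>i\<in>UNIV. \<Sum>c\<in>UNIV. A i $ a i $ c * B i $ c $ b i)" for a b
    using prod_sum_PiE[of "UNIV :: 'a set" "\<lambda>_. UNIV" "\<lambda>i c. A i $ a i $ c * B i $ c $ b i"]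
    by (simp add: prod.distrib PiE_UNIV_domain)
  then show ?thesis
    by (simp add: tensor_op_def matrix_matrix_mult_def vec_eq_iff)
qed

lemma dagger_tensor_op: "dagger (tensor_op A) = tensor_op (\<lambda>i. dagger (A i))"
  by (simp add: dagger_def tensor_op_def vec_eq_iff)

lemma tensor_op_id [simp]: "tensor_op (\<lambda>i. mat 1) = mat 1"
proof -
  have "(\<Prod>i\<in>UNIV. if a i = b i then 1 else 0) = (if a = b then 1 else (0::complex))"
    for a b :: "'a \<Rightarrow> bool"
    by (auto simp: fun_eq_iff intro!: prod_zero)
  then show ?thesis
    by (simp add: tensor_op_def mat_def vec_eq_iff)
qed

lemma unitary_tensor_op: "(\<And>i. unitary (A i)) \<Longrightarrow> unitary (tensor_op A)"
  by (simp add: unitary_def dagger_tensor_op tensor_op_mult)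

section \<open>Codes stabilized by generated groups\<close>

lemma group_unitary_group: "group unitary_group"
proof (rule groupI)
  fix A :: "complex ^ 'a ^ 'a"
  assume "A \<in> carrier unitary_group"
  then show "\<exists>B\<in>carrier unitary_group. B \<otimes>\<^bsub>unitary_group\<^esub> A = \<one>\<^bsub>unitary_group\<^esub>"
    by (intro bexI[of _ "dagger A"]) (auto simp: unitary_group_def unitary_def dagger_def)
qed (auto simp: unitary_group_def unitary_mult unitary_mat matrix_mul_assoc)

text \<open>Fixing a vector passes to products and inverses, so membership in a code can be tested
  on generators alone.\<close>

lemma stabilized_code_generate:
  assumes "G \<subseteq> carrier unitary_group"
  shows "stabilized_code (generate unitary_group G) = stabilized_code G"
proof -
  interpret group unitary_group by (rule group_unitary_group)
  have "g *v \<psi> = \<psi>" if "\<psi> \<in> stabilized_code G" "g \<in> generate unitary_group G" for g \<psi>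
    using that(2)
  proof induction
    case one
    then show ?case by (simp add: unitary_group_def)
  next
    case (incl h)
    then show ?case using that(1) by (simp add: stabilized_code_def)
  next
    case (inv h)
    then have "h *v \<psi> = \<psi>" "inv\<^bsub>unitary_group\<^esub> h ** h = mat 1"
      using that(1) l_inv[of h] assms by (auto simp: stabilized_code_def unitary_group_def)
    then show ?case
      by (metis matrix_vector_mul_assoc matrix_vector_mul_lid)
  next
    case (eng h k)
    then show ?case by (simp add: unitary_group_def flip: matrix_vector_mul_assoc)
  qed
  then show ?thesis
    by (auto simp: stabilized_code_def intro: generate.incl)
qed

section \<open>Projectors onto codes\<close>

lemma code_projector:
  assumes "vec.subspace C"
  shows "is_projector_onto (code_projector C) C"
  unfolding code_projector_def using ex1_projector_onto[OF assms] by (rule theI')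

lemma projector_onto_fixes:
  assumes "is_projector_onto Q C"
  shows "\<psi> \<in> C \<longleftrightarrow> Q *v \<psi> = \<psi>"
proof -
  have "Q *v (Q *v \<phi>) = Q *v \<phi>" for \<phi>
    using assms by (simp add: is_projector_onto_def matrix_vector_mul_assoc)
  moreover have "C = range ((*v) Q)"
    using assms by (simp add: is_projector_onto_def)
  ultimately show ?thesis
    by (auto intro: range_eqI[of _ _ \<psi>])
qed

lemma projector_column_in:
  assumes "is_projector_onto Q C"
  shows "(\<chi> i. Q $ i $ j) \<in> C"
proof -
  have "(\<chi> i. Q $ i $ j) = Q *v axis j 1"
    by (simp add: vec_eq_iff matrix_vector_mult_def axis_def if_distrib cong: if_cong)
  then show ?thesis
    using assms by (auto simp: is_projector_onto_def)
qed

text \<open>As \<open>Q\<close> is self-adjoint, the entry \<open>(a, b)\<close> of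
  \<open>Q ** E ** Q\<close> is the sesquilinear form of \<open>E\<close> on columns
  \<open>a\<close> and \<open>b\<close> of \<open>Q\<close>, and these columns are code
  states.\<close>

lemma compress_eq_zeroI:
  assumes Q: "is_projector_onto Q C"
    and zero: "\<And>\<phi> \<psi>. \<phi> \<in> C \<Longrightarrow> \<psi> \<in> C \<Longrightarrow> (\<Sum>e\<in>UNIV. \<Sum>f\<in>UNIV. cnj (\<phi> $ e) * E $ e $ f * \<psi> $ f) = 0"
  shows "Q ** E ** Q = 0"
proof -
  have "cnj (Q $ e $ a) = Q $ a $ e" for a e
  proof -
    have "dagger Q $ a $ e = Q $ a $ e"
      using Q by (simp add: is_projector_onto_def)
    then show ?thesis by (simp add: dagger_def)
  qed
  moreover have "(Q ** E ** Q) $ a $ b = (\<Sum>f\<in>UNIV. \<Sum>e\<in>UNIV. Q $ a $ e * E $ e $ f * Q $ f $ b)" for a b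
    by (simp add: matrix_matrix_mult_def sum_distrib_right)
  ultimately have "(Q ** E ** Q) $ a $ b
      = (\<Sum>e\<in>UNIV. \<Sum>f\<in>UNIV. cnj (Q $ e $ a) * E $ e $ f * Q $ f $ b)" for a b
    by (subst sum.swap) simp
  then show ?thesis
    using zero[OF projector_column_in[OF Q] projector_column_in[OF Q]]
    by (simp add: vec_eq_iff)
qed

section \<open>XP operators\<close>

lemma omega_power_8: "omega ^ 8 = -1"
proof -
  have "omega ^ 8 = exp (of_nat 8 * (\<i> * complex_of_real pi / 8))"
    unfolding omega_def by (rule exp_of_nat_mult[symmetric])
  also have "\<dots> = exp (\<i> * complex_of_real pi)" by simp
  finally show ?thesis by simp
qed

lemma omega_power_16: "omega ^ 16 = 1"
  using power_mult[of omega 8 2] by (simp add: omega_power_8)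

lemma omega_power_mod: "omega ^ n = omega ^ (n mod 16)"
proof -
  have "omega ^ n = omega ^ (16 * (n div 16) + n mod 16)" by simp
  also have "\<dots> = omega ^ (n mod 16)"
    unfolding power_add power_mult omega_power_16 by simp
  finally show ?thesis .
qed

lemma omega_power_eqI: "m mod 16 = n mod 16 \<Longrightarrow> omega ^ m = omega ^ n"
  by (metis omega_power_mod)

lemma omega_neq_0 [simp]: "omega \<noteq> 0"
  by (simp add: omega_def)

lemma norm_omega: "norm omega = 1"
  unfolding omega_def by (simp add: norm_exp_eq_Re)

lemma omega_cnj: "omega * cnj omega = 1"
  using complex_norm_square[of omega] unfolding norm_omega by simp

lemma omega_power_cnj: "omega ^ n * cnj (omega ^ n) = 1"
  by (simp add: omega_cnj flip: power_mult_distrib)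

section \<open>Matrix entries of Pauli and XP operators\<close>

lemma UNIV_bool_sum: "sum f (UNIV :: bool set) = f False + f True"
  by (simp add: UNIV_bool add.commute)

lemma pauli_mat_nth:
  "pauli_mat PauliI $ a $ b = of_bool (a = b)"
  "pauli_mat PauliX $ a $ b = of_bool (a \<noteq> b)"
  "pauli_mat PauliY $ a $ b = of_bool (a \<noteq> b) * (if a then \<i> else - \<i>)"
  "pauli_mat PauliZ $ a $ b = of_bool (a = b) * (if a then -1 else 1)"
  by (cases a; cases b; simp add: qubit_mat_def mat_def)+

lemma unitary_PauliX: "unitary (pauli_mat PauliX)"
  unfolding unitary_def
  by (simp add: vec_eq_iff matrix_matrix_mult_def dagger_def pauli_mat_nth UNIV_bool_sum mat_def del: pauli_mat.simps)

lemma unitary_P_mat: "unitary P_mat"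
  unfolding unitary_def P_mat_def qubit_mat_def
  using omega_power_cnj[of 2]
  by (auto simp: vec_eq_iff matrix_matrix_mult_def dagger_def UNIV_bool_sum mat_def mult.commute)

lemma unitary_XP8: "unitary (XP8 x z p)"
  unfolding XP8_def
  by (intro unitary_mult unitary_mat omega_power_cnj unitary_tensor_op unitary_mat_pow unitary_PauliX unitary_P_mat)

lemma mat_pow_PauliX_nth: "mat_pow (pauli_mat PauliX) n $ a $ b = of_bool (a = (b \<noteq> odd n))"
  by (induction n arbitrary: a)
    (auto simp: matrix_matrix_mult_def UNIV_bool_sum pauli_mat_nth mat_def simp del: pauli_mat.simps)

lemma mat_pow_P_mat_nth:
  "mat_pow P_mat n $ a $ b = of_bool (a = b) * (if a then omega ^ (2 * n) else 1)"
  by (induction n arbitrary: a)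
    (auto simp: matrix_matrix_mult_def UNIV_bool_sum P_mat_def qubit_mat_def mat_def power2_eq_square)

text \<open>The action of the X-part on basis labels. It is an involution, so rows and columns need
  not be distinguished.\<close>

definition flip :: "nat ^ 'n \<Rightarrow> ('n \<Rightarrow> bool) \<Rightarrow> ('n \<Rightarrow> bool)" where
  "flip x a = (\<lambda>i. a i \<noteq> odd (x $ i))"

text \<open>The factor 2 comes from the entry \<open>omega ^ 2\<close> of \<open>P_mat\<close>. The
  phase is read off at the column \<open>b\<close>, since the power of P acts before that of
  X.\<close>

definition XP8_phase :: "nat ^ 'n \<Rightarrow> nat \<Rightarrow> ('n::finite \<Rightarrow> bool) \<Rightarrow> nat" where
  "XP8_phase z p b = p + 2 * (\<Sum>i\<in>UNIV. z $ i * of_bool (b i))"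

lemma flip_flip [simp]: "flip x (flip x a) = a"
  by (auto simp: flip_def)

lemma prod_of_bool: "(\<Prod>i\<in>A. of_bool (P i)) = (of_bool (\<forall>i\<in>A. P i) :: complex)" if "finite A"
  using that by induction auto

lemma XP8_nth: "XP8 x z p $ a $ b = (if b = flip x a then omega ^ XP8_phase z p b else 0)"
proof -
  have "(mat_pow (pauli_mat PauliX) m ** mat_pow P_mat n) $ s $ t
      = of_bool (t = (s \<noteq> odd m)) * omega ^ (2 * (n * of_bool t))" for m n s t
    unfolding matrix_matrix_mult_def
    by (auto simp: UNIV_bool_sum mat_pow_PauliX_nth mat_pow_P_mat_nth simp del: pauli_mat.simps)
  moreover have "omega ^ XP8_phase z p b = omega ^ p * (\<Prod>i\<in>UNIV. omega ^ (2 * (z $ i * of_bool (b i))))"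
    unfolding XP8_phase_def power_add sum_distrib_left power_sum ..
  ultimately show ?thesis
    unfolding XP8_def tensor_op_def flip_def fun_eq_iff mat_matrix_mult_nth vec_lambda_beta
    by (simp add: prod.distrib prod_of_bool del: pauli_mat.simps of_bool_eq_0_iff)
qed

lemma XP8_mult_nth: "(XP8 x z p *v \<psi>) $ a = omega ^ XP8_phase z p (flip x a) * \<psi> $ flip x a"
  by (simp add: matrix_vector_mult_def XP8_nth if_distrib if_distribR cong: if_cong)

lemma XP_code_iff: "\<psi> \<in> XP_code \<longleftrightarrow> (\<forall>g\<in>XP_generators. g *v \<psi> = \<psi>)"
proof -
  have "XP_generators \<subseteq> carrier unitary_group"
    by (auto simp: XP_generators_def unitary_group_def unitary_XP8)
  then show ?thesis
    by (simp add: XP_code_def stabilized_code_generate) (simp add: stabilized_code_def)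
qed

section \<open>The Hamming code\<close>

lemma exhaust_7: "(i::7) = 1 \<or> i = 2 \<or> i = 3 \<or> i = 4 \<or> i = 5 \<or> i = 6 \<or> i = 7"
proof (induct i)
  case (of_int z)
  then have "0 \<le> z" "z < 7" by simp_all
  \<comment> \<open>The representative 0 is the element written \<open>7\<close>.\<close>
  then have "z = 0 \<or> z = 1 \<or> z = 2 \<or> z = 3 \<or> z = 4 \<or> z = 5 \<or> z = 6" by arith
  then show ?case by auto
qed

lemma UNIV_7: "(UNIV :: 7 set) = {1,2,3,4,5,6,7}"
  using exhaust_7 by auto

lemma forall_7: "(\<forall>i::7. P i) \<longleftrightarrow> P 1 \<and> P 2 \<and> P 3 \<and> P 4 \<and> P 5 \<and> P 6 \<and> P 7"
  using exhaust_7 by metis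

lemma prod_7: "prod f (UNIV :: 7 set) = f 1 * f 2 * f 3 * f 4 * f 5 * f 6 * f 7"
  for f :: "7 \<Rightarrow> 'a::comm_monoid_mult"
  unfolding UNIV_7 by (simp add: mult.assoc)

lemma sum_7: "sum f (UNIV :: 7 set) = f 1 + f 2 + f 3 + f 4 + f 5 + f 6 + f 7"
  for f :: "7 \<Rightarrow> 'a::comm_monoid_add"
  unfolding UNIV_7 by (simp add: add.assoc)

lemma vector_7:
  "(vector [a1,a2,a3,a4,a5,a6,a7] :: 'a::zero ^ 7) $ 1 = a1"
  "(vector [a1,a2,a3,a4,a5,a6,a7] :: 'a::zero ^ 7) $ 2 = a2"
  "(vector [a1,a2,a3,a4,a5,a6,a7] :: 'a::zero ^ 7) $ 3 = a3"
  "(vector [a1,a2,a3,a4,a5,a6,a7] :: 'a::zero ^ 7) $ 4 = a4"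
  "(vector [a1,a2,a3,a4,a5,a6,a7] :: 'a::zero ^ 7) $ 5 = a5"
  "(vector [a1,a2,a3,a4,a5,a6,a7] :: 'a::zero ^ 7) $ 6 = a6"
  "(vector [a1,a2,a3,a4,a5,a6,a7] :: 'a::zero ^ 7) $ 7 = a7"
  unfolding vector_def by simp_all

section \<open>Parity checks and minimum distance\<close>

definition hamming :: "(7 \<Rightarrow> bool) \<Rightarrow> bool" where
  "hamming e \<longleftrightarrow> (e 1 \<longleftrightarrow> e 3) = (e 5 \<longleftrightarrow> e 7) \<and> (e 2 \<longleftrightarrow> e 3) = (e 6 \<longleftrightarrow> e 7)
    \<and> (e 4 \<longleftrightarrow> e 5) = (e 6 \<longleftrightarrow> e 7)"

text \<open>An equation \<open>(a \<longleftrightarrow> b) = (c \<longleftrightarrow> d)\<close>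
  says that the four bits have even parity, and parity is additive under exclusive or.\<close>

lemma even_parity_diff:
  assumes "(a \<longleftrightarrow> b) = (c \<longleftrightarrow> d)" "(a' \<longleftrightarrow> b') = (c' \<longleftrightarrow> d')"
  shows "((a \<noteq> a') \<longleftrightarrow> (b \<noteq> b')) = ((c \<noteq> c') \<longleftrightarrow> (d \<noteq> d'))"
  using assms by (cases a; cases b; cases c; cases a'; cases b'; cases c') simp_all

lemma hamming_diff: "hamming e \<Longrightarrow> hamming f \<Longrightarrow> hamming (\<lambda>k. e k \<noteq> f k)"
  unfolding hamming_def by (intro conjI even_parity_diff) simp_all

text \<open>The columns of the check matrix are nonzero and pairwise distinct. The case
  \<open>i = j\<close> covers weight one.\<close>

lemma hamming_weight_3:
  assumes "hamming d" and "\<forall>k. d k \<longrightarrow> k = i \<or> k = j"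
  shows "\<forall>k. \<not> d k"
  using exhaust_7[of i] exhaust_7[of j] assms unfolding hamming_def forall_7
  by (elim disjE) simp_all

lemma hamming_distance_3:
  assumes "hamming e" "hamming f" and "\<forall>k. e k \<noteq> f k \<longrightarrow> k = i \<or> k = j"
  shows "e = f"
  using hamming_weight_3[OF hamming_diff[OF assms(1,2)] assms(3)] by auto

definition check_rows :: "(nat ^ 7) set" where
  "check_rows = {vector [1,0,1,0,1,0,1], vector [0,1,1,0,0,1,1], vector [0,0,0,1,1,1,1]}"

text \<open>Column \<open>i\<close> of the check matrix is the binary expansion of the number
  \<open>i\<close> from 1 to 7, with the lowest bit in the first row.\<close>

lemma check_rows_nonzero: "\<exists>x\<in>check_rows. odd (x $ i)"
  using exhaust_7[of i] unfolding check_rows_def by (elim disjE) (simp_all add: vector_7)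

lemma check_rows_separate: "i \<noteq> j \<Longrightarrow> \<exists>x\<in>check_rows. odd (x $ i) \<noteq> odd (x $ j)"
  using exhaust_7[of i] exhaust_7[of j] unfolding check_rows_def
  by (elim disjE) (simp_all add: vector_7)

lemma check_rows_isolate:
  assumes "S \<noteq> {}" "S \<subseteq> {i, j}"
  shows "\<exists>x\<in>check_rows. \<exists>k. {l\<in>S. odd (x $ l)} = {k}"
proof (cases "i \<in> S \<and> j \<in> S \<and> i \<noteq> j")
  case True
  then obtain x where x: "x \<in> check_rows" "odd (x $ i) \<noteq> odd (x $ j)"
    using check_rows_separate by blast
  have S: "S = {i, j}" using True assms(2) by blast
  show ?thesis
  proof (cases "odd (x $ i)")
    case True
    then have "{l\<in>S. odd (x $ l)} = {i}" using S x(2) by blast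
    then show ?thesis using x(1) by blast
  next
    case False
    then have "{l\<in>S. odd (x $ l)} = {j}" using S x(2) by blast
    then show ?thesis using x(1) by blast
  qed
next
  case False
  then have "S = {i} \<or> S = {j}" using assms by blast
  then obtain k where k: "S = {k}" by blast
  then show ?thesis using check_rows_nonzero[of k] by auto
qed

section \<open>The XP code\<close>

text \<open>Each check row is the X-part of a generator. Its \<open>z\<close> and \<open>p\<close>
  are fixed before the state, so all code states share the same phases.\<close>

lemma XP_code_shift:
  assumes "x \<in> check_rows"
  obtains z p where "\<And>\<psi> a. \<psi> \<in> XP_code \<Longrightarrow> \<psi> $ a = omega ^ XP8_phase z p (flip x a) * \<psi> $ flip x a"
proof -
  obtain z p where "XP8 x z p \<in> XP_generators"
    using assms unfolding check_rows_def XP_generators_def by blast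
  then have "\<psi> $ a = omega ^ XP8_phase z p (flip x a) * \<psi> $ flip x a" if "\<psi> \<in> XP_code" for \<psi> a
    using that by (metis XP_code_iff XP8_mult_nth)
  then show ?thesis using that by blast
qed

text \<open>The two states pick up the same phase, which cancels against its conjugate.\<close>

lemma XP_code_cnj_shift:
  assumes "x \<in> check_rows" "\<phi> \<in> XP_code" "\<psi> \<in> XP_code"
  shows "cnj (\<phi> $ a) * \<psi> $ a = cnj (\<phi> $ flip x a) * \<psi> $ flip x a"
proof -
  obtain n where "\<phi> $ a = omega ^ n * \<phi> $ flip x a" "\<psi> $ a = omega ^ n * \<psi> $ flip x a"
    using XP_code_shift[OF assms(1)] assms(2,3) by metis
  then show ?thesis
    using omega_power_cnj[of n] by (simp add: mult_ac)
qed

lemma flip_zero: "flip (vector [0,0,0,0,0,0,0]) a = a" for a :: "7 \<Rightarrow> bool"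
  by (simp add: flip_def fun_eq_iff forall_7 vector_7)

text \<open>The last three generators are diagonal. Each set bit in a check contributes
  \<open>omega ^ 8\<close>, that is -1, so their eigenvalues are the signs of the three parity
  checks.\<close>

lemma XP_code_support:
  assumes "\<psi> \<in> XP_code" "\<psi> $ e \<noteq> 0"
  shows "hamming e"
proof -
  have *: "omega ^ XP8_phase z p e = 1" if "XP8 (vector [0,0,0,0,0,0,0]) z p \<in> XP_generators" for z p
  proof -
    have "omega ^ XP8_phase z p e * \<psi> $ e = \<psi> $ e"
      using assms(1) that by (metis XP_code_iff XP8_mult_nth flip_zero)
    then show ?thesis using assms(2) by simp
  qed
  have "omega ^ 24 = -1" "omega ^ 32 = 1"
    using omega_power_mod[of 24] omega_power_mod[of 32] by (simp_all add: omega_power_8)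
  note omega_powers = omega_power_8 omega_power_16 this
  have z: "omega ^ XP8_phase (vector [4,0,4,0,4,0,4]) 0 e = 1"
    "omega ^ XP8_phase (vector [0,4,4,0,0,4,4]) 0 e = 1"
    "omega ^ XP8_phase (vector [0,0,0,4,4,4,4]) 0 e = 1"
    by (rule *, simp add: XP_generators_def)+
  show ?thesis
    unfolding hamming_def
    using z[unfolded XP8_phase_def sum_7 vector_7]
    by (cases "e 1"; cases "e 2"; cases "e 3"; cases "e 4"; cases "e 5"; cases "e 6"; cases "e 7")
      (simp_all add: omega_powers)
qed

text \<open>On a Hamming word this is the parity of all seven bits, as bits 4 to 7 have even parity.
  Each check row meets the positions 1, 2, 3 evenly, so shifts by rows preserve it.\<close>

definition odd_parity :: "(7 \<Rightarrow> bool) \<Rightarrow> bool" where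
  "odd_parity e \<longleftrightarrow> (e 1 \<noteq> (e 2 \<noteq> e 3))"

text \<open>
  The phases relative to the constant word of the same parity, obtained by applying the generators;
  bits 1, 2, 4 and the parity determine a Hamming word.
\<close>

definition word_phase :: "(7 \<Rightarrow> bool) \<Rightarrow> nat" where
  "word_phase e = (if odd_parity e then [11,7,7,3,6,6,8,0] else [0,0,2,10,13,1,1,5])
    ! (of_bool (e 1) + 2 * of_bool (e 2) + 4 * of_bool (e 4))"

text \<open>An unnormalised basis state with coefficient 1 at the constant word
  \<open>t\<close>.\<close>

definition logical :: "bool \<Rightarrow> 7 state" where
  "logical t = (\<chi> e. if hamming e \<and> odd_parity e = t then omega ^ word_phase e else 0)"

lemma XP8_fixes_logical:
  assumes *: "\<And>a. hamming a \<Longrightarrow> hamming (flip x a) \<and> odd_parity (flip x a) = odd_parity a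
    \<and> (XP8_phase z p (flip x a) + word_phase (flip x a)) mod 16 = word_phase a mod 16"
  shows "XP8 x z p *v logical t = logical t"
proof -
  have "hamming (flip x a) \<longleftrightarrow> hamming a" for a
    using *[of a] *[of "flip x a"] by auto
  then have "(XP8 x z p *v logical t) $ a = logical t $ a" for a
  proof (cases "hamming a")
    case True
    have "omega ^ XP8_phase z p (flip x a) * omega ^ word_phase (flip x a) = omega ^ word_phase a"
      unfolding power_add[symmetric] using *[OF True] by (intro omega_power_eqI) blast
    then show ?thesis
      using *[OF True] True by (simp add: XP8_mult_nth logical_def)
  next
    case False
    then show ?thesis
      using \<open>\<And>a. hamming (flip x a) \<longleftrightarrow> hamming a\<close> by (simp add: XP8_mult_nth logical_def)
  qed
  then show ?thesis by (simp add: vec_eq_iff)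
qed

lemma logical_in_XP_code: "logical t \<in> XP_code"
proof -
  let ?P = "\<lambda>x z p a. hamming a \<longrightarrow> hamming (flip x a) \<and> odd_parity (flip x a) = odd_parity a
    \<and> (XP8_phase z p (flip x a) + word_phase (flip x a)) mod 16 = word_phase a mod 16"
  have "?P (vector [1,0,1,0,1,0,1]) (vector [0,0,2,0,0,4,6]) 0 a"
    "?P (vector [0,1,1,0,0,1,1]) (vector [0,3,6,0,4,3,2]) 2 a"
    "?P (vector [0,0,0,1,1,1,1]) (vector [0,0,0,2,0,7,2]) 13 a"
    "?P (vector [0,0,0,0,0,0,0]) (vector [4,0,4,0,4,0,4]) 0 a"
    "?P (vector [0,0,0,0,0,0,0]) (vector [0,4,4,0,0,4,4]) 0 a"
    "?P (vector [0,0,0,0,0,0,0]) (vector [0,0,0,4,4,4,4]) 0 a" for a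
    unfolding hamming_def odd_parity_def flip_def XP8_phase_def word_phase_def sum_7
    by (cases "a 1"; cases "a 2"; cases "a 3"; cases "a 4"; cases "a 5"; cases "a 6"; cases "a 7";
      simp add: vector_7)+
  then show ?thesis
    by (simp add: XP_code_iff XP_generators_def XP8_fixes_logical)
qed

lemma XP_code_zero_shift:
  assumes "x \<in> check_rows" "\<psi> \<in> XP_code"
  shows "\<psi> $ flip x a = 0 \<longleftrightarrow> \<psi> $ a = 0"
  using XP_code_shift[OF assms(1)] assms(2) by (metis mult_eq_0_iff omega_neq_0 power_eq_0_iff)

text \<open>Shifts by rows do not affect vanishing and can set bits 1, 2, 4 independently. A Hamming
  word of parity \<open>t\<close> with these three bits equal to \<open>t\<close> is
  constant.\<close>

lemma XP_code_eq_zeroI: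
  assumes \<psi>: "\<psi> \<in> XP_code" and zero: "\<And>t. \<psi> $ (\<lambda>_. t) = 0"
  shows "\<psi> = 0"
proof -
  have "\<psi> $ e = 0" for e
  proof (rule ccontr)
    assume "\<psi> $ e \<noteq> 0"
    then have e: "hamming e" using XP_code_support[OF \<psi>] by blast
    define t where "t = odd_parity e"
    define f where "f i x a = (if e i = t then a else flip x a)" for i x and a :: "7 \<Rightarrow> bool"
    have nz: "\<psi> $ f i x a = 0 \<longleftrightarrow> \<psi> $ a = 0" if "x \<in> check_rows" for i x a
      using XP_code_zero_shift[OF that \<psi>] by (simp add: f_def)
    \<comment> \<open>Each row contains exactly one of the positions 1, 2, 4.\<close>
    have "f 1 (vector [1,0,1,0,1,0,1]) (f 2 (vector [0,1,1,0,0,1,1]) (f 4 (vector [0,0,0,1,1,1,1]) e)) = (\<lambda>_. t)"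
      using e unfolding f_def flip_def hamming_def t_def odd_parity_def fun_eq_iff forall_7
      by (cases "e 1"; cases "e 2"; cases "e 3"; cases "e 4"; cases "e 5"; cases "e 6"; cases "e 7")
        (simp_all add: vector_7)
    then have "\<psi> $ e = 0"
      using nz zero by (metis check_rows_def insertCI)
    then show False using \<open>\<psi> $ e \<noteq> 0\<close> by blast
  qed
  then show ?thesis by (simp add: vec_eq_iff)
qed

section \<open>A basis of the XP code and its dimension\<close>

lemma hamming_const: "hamming (\<lambda>_. t)"
  by (simp add: hamming_def)

lemma logical_const: "logical t $ (\<lambda>_. t') = of_bool (t = t')"
  by (cases t; cases t') (simp_all add: logical_def hamming_const odd_parity_def word_phase_def)

lemma subspace_XP_code: "vec.subspace XP_code"
  by (simp add: XP_code_def subspace_stabilized_code)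

lemma XP_code_eq_span: "XP_code = vec.span {logical False, logical True}"
proof
  show "vec.span {logical False, logical True} \<subseteq> XP_code"
    by (rule vec.span_minimal) (auto simp: logical_in_XP_code subspace_XP_code)
  show "XP_code \<subseteq> vec.span {logical False, logical True}"
  proof
    fix \<psi> assume \<psi>: "\<psi> \<in> XP_code"
    \<comment> \<open>The values at the two constant words are the coordinates in the logical
      basis.\<close>
    let ?\<phi> = "\<psi> $ (\<lambda>_. False) *s logical False + \<psi> $ (\<lambda>_. True) *s logical True"
    have "?\<phi> \<in> XP_code"
      by (intro vec.subspace_add vec.subspace_scale subspace_XP_code logical_in_XP_code)
    then have "\<psi> - ?\<phi> \<in> XP_code"
      by (intro vec.subspace_diff subspace_XP_code \<psi>)
    moreover have "(\<psi> - ?\<phi>) $ (\<lambda>_. t) = 0" for t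
      by (cases t) (simp_all add: logical_const)
    ultimately have "\<psi> - ?\<phi> = 0"
      by (rule XP_code_eq_zeroI)
    then have "\<psi> = ?\<phi>"
      by (simp only: right_minus_eq)
    then show "\<psi> \<in> vec.span {logical False, logical True}"
      by (metis insertCI vec.span_add vec.span_base vec.span_scale)
  qed
qed

lemma dim_XP_code: "vec.dim XP_code = 2"
proof -
  have "logical False \<notin> vec.span {logical True}"
  proof
    assume "logical False \<in> vec.span {logical True}"
    then obtain k where "logical False = k *s logical True"
      by (auto simp: vec.span_singleton)
    then have "logical False $ (\<lambda>_. False) = k * logical True $ (\<lambda>_. False)"
      by simp
    then show False by (simp add: logical_const)
  qed
  moreover have "logical True \<noteq> 0"
    using logical_const[of True True] by auto
  ultimately have "vec.independent {logical False, logical True}" "logical False \<noteq> logical True"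
    using vec.span_base[of "logical True" "{logical True}"] by (auto simp: vec.independent_insert)
  then show ?thesis
    unfolding XP_code_eq_span by (subst vec.dim_span_eq_card_independent) simp_all
qed

section \<open>Distance\<close>

lemma pauli_string_nth_eq_0:
  assumes "e k \<noteq> f k" "E k = PauliI"
  shows "pauli_string E $ e $ f = 0"
  unfolding pauli_string_def tensor_op_def vec_lambda_beta
  by (rule prod_zero, simp, rule bexI[of _ k])
    (use assms in \<open>simp_all add: pauli_mat_nth del: pauli_mat.simps\<close>)

text \<open>X and Y have zero diagonal, and the two diagonal entries of Z are opposite.\<close>

lemma pauli_mat_diag_not:
  "P \<noteq> PauliI \<Longrightarrow> pauli_mat P $ (\<not> a) $ (\<not> a) = - pauli_mat P $ a $ a"
  by (cases P) (simp_all add: pauli_mat_nth del: pauli_mat.simps)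

lemma pauli_string_diag_flip:
  assumes "{l \<in> {l. E l \<noteq> PauliI}. odd (x $ l)} = {k}"
  shows "pauli_string E $ flip x e $ flip x e = - pauli_string E $ e $ e"
proof -
  have "pauli_mat (E l) $ flip x e l $ flip x e l
      = (if l = k then -1 else 1) * pauli_mat (E l) $ e l $ e l" for l
  proof (cases "l = k")
    case True
    then have "E l \<noteq> PauliI" "flip x e l = (\<not> e l)"
      using assms by (auto simp: flip_def)
    then show ?thesis using True pauli_mat_diag_not by simp
  next
    case False
    then have "E l = PauliI \<or> flip x e l = e l"
      using assms by (auto simp: flip_def)
    then show ?thesis using False by (auto simp: pauli_mat_nth simp del: pauli_mat.simps)
  qed
  then show ?thesis
    by (simp add: pauli_string_def tensor_op_def prod.distrib)
qed

lemma weight_2_error_detected: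
  assumes supp: "{l. E l \<noteq> PauliI} \<noteq> {}" "{l. E l \<noteq> PauliI} \<subseteq> {i, j}"
    and \<phi>: "\<phi> \<in> XP_code" and \<psi>: "\<psi> \<in> XP_code"
  shows "(\<Sum>e\<in>UNIV. \<Sum>f\<in>UNIV. cnj (\<phi> $ e) * pauli_string E $ e $ f * \<psi> $ f) = 0"
proof -
  obtain x k where x: "x \<in> check_rows" and k: "{l \<in> {l. E l \<noteq> PauliI}. odd (x $ l)} = {k}"
    using check_rows_isolate[OF supp] by blast
  define G where "G e = cnj (\<phi> $ e) * pauli_string E $ e $ e * \<psi> $ e" for e
  \<comment> \<open>Distinct Hamming words differ in at least three positions, hence at one where
    the error acts as the identity.\<close>
  have off: "cnj (\<phi> $ e) * pauli_string E $ e $ f * \<psi> $ f = 0" if "f \<noteq> e" for e f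
  proof (rule ccontr)
    assume nz: "\<not> ?thesis"
    then have "hamming e" "hamming f"
      using XP_code_support \<phi> \<psi> by auto
    then obtain l where "e l \<noteq> f l" "l \<noteq> i" "l \<noteq> j"
      using hamming_distance_3 \<open>f \<noteq> e\<close> by blast
    then have "pauli_string E $ e $ f = 0"
      using supp(2) by (intro pauli_string_nth_eq_0) auto
    then show False using nz by simp
  qed
  have "(\<Sum>f\<in>UNIV. cnj (\<phi> $ e) * pauli_string E $ e $ f * \<psi> $ f)
      = (\<Sum>f\<in>{e}. cnj (\<phi> $ e) * pauli_string E $ e $ f * \<psi> $ f)" for e
    by (rule sum.mono_neutral_right) (use off in auto)
  then have sum_G: "(\<Sum>e\<in>UNIV. \<Sum>f\<in>UNIV. cnj (\<phi> $ e) * pauli_string E $ e $ f * \<psi> $ f) = sum G UNIV"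
    by (simp add: G_def)
  \<comment> \<open>Reindexing by the shift keeps the product of amplitudes and negates the diagonal
    entry of the error, so the sum equals its negative.\<close>
  have "sum G UNIV = (\<Sum>e\<in>UNIV. G (flip x e))"
    by (rule sum.reindex_bij_witness[of _ "flip x" "flip x"]) simp_all
  also have "\<dots> = (\<Sum>e\<in>UNIV. - G e)"
  proof (rule sum.cong[OF refl])
    fix e
    have "G (flip x e) = (cnj (\<phi> $ flip x e) * \<psi> $ flip x e) * pauli_string E $ flip x e $ flip x e"
      by (simp add: G_def mult_ac)
    also have "\<dots> = - G e"
      unfolding XP_code_cnj_shift[OF x \<phi> \<psi>, symmetric] pauli_string_diag_flip[OF k]
      by (simp add: G_def mult_ac)
    finally show "G (flip x e) = - G e" .
  qed
  finally have "sum G UNIV = - sum G UNIV"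
    by (simp add: sum_negf)
  then show ?thesis using sum_G by simp
qed

lemma XP_projector: "is_projector_onto (code_projector XP_code) XP_code"
  by (rule code_projector[OF subspace_XP_code])

lemma light_error_detected:
  assumes "pauli_weight E < 3"
  shows "\<exists>c. code_projector XP_code ** pauli_string E ** code_projector XP_code
    = mat c ** code_projector XP_code"
proof (cases "{l. E l \<noteq> PauliI} = {}")
  case True
  then have "pauli_string E = mat 1"
    by (simp add: pauli_string_def)
  then show ?thesis
    using XP_projector by (intro exI[of _ 1]) (simp add: is_projector_onto_def)
next
  case False
  have "card {l. E l \<noteq> PauliI} = 1 \<or> card {l. E l \<noteq> PauliI} = 2"
    using assms False unfolding pauli_weight_def
    by (metis One_nat_def Suc_1 card_eq_0_iff finite less_Suc_eq less_one numeral_3_eq_3)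
  then obtain i j where "{l. E l \<noteq> PauliI} \<subseteq> {i, j}"
    by (metis card_1_singletonE card_2_iff order_refl singleton_insert_inj_eq)
  then have "code_projector XP_code ** pauli_string E ** code_projector XP_code = 0"
    using weight_2_error_detected[OF False] by (intro compress_eq_zeroI[OF XP_projector]) blast
  then show ?thesis
    by (intro exI[of _ 0]) (simp add: vec_eq_iff)
qed

text \<open>The positions 1, 2, 3 support a Hamming word of weight 3; the resulting sign on a basis
  word is its \<open>odd_parity\<close>.\<close>

definition logical_Z :: "7 \<Rightarrow> pauli" where
  "logical_Z i = (if i \<in> {1, 2, 3} then PauliZ else PauliI)"

lemma pauli_weight_logical_Z: "pauli_weight logical_Z = 3"
proof -
  have "{i. logical_Z i \<noteq> PauliI} = {1, 2, 3}" by (auto simp: logical_Z_def)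
  then show ?thesis by (simp add: pauli_weight_def)
qed

lemma logical_Z_nth:
  "pauli_string logical_Z $ e $ f = (if f = e then (-1) ^ of_bool (odd_parity e) else 0)"
proof (cases "f = e")
  case True
  then show ?thesis
    unfolding pauli_string_def tensor_op_def vec_lambda_beta prod_7
    by (simp add: logical_Z_def pauli_mat_nth odd_parity_def del: pauli_mat.simps)
next
  case False
  then obtain k where "e k \<noteq> f k" by auto
  then have "pauli_mat (logical_Z k) $ e k $ f k = 0"
    by (simp add: logical_Z_def pauli_mat_nth del: pauli_mat.simps)
  then show ?thesis
    using False unfolding pauli_string_def tensor_op_def vec_lambda_beta by (auto intro!: prod_zero)
qed

lemma logical_Z_mult: "pauli_string logical_Z *v logical t = (-1) ^ of_bool t *s logical t"
proof -
  have "(pauli_string logical_Z *v \<psi>) $ e = (-1) ^ of_bool (odd_parity e) * \<psi> $ e" for \<psi> e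
    by (simp add: matrix_vector_mult_def logical_Z_nth if_distrib if_distribR cong: if_cong)
  then show ?thesis
    by (simp add: vec_eq_iff) (simp add: logical_def)
qed

text \<open>The two logical states are eigenvectors with eigenvalues 1 and -1, so no single
  \<open>c\<close> serves both.\<close>

lemma logical_Z_undetected:
  "code_projector XP_code ** pauli_string logical_Z ** code_projector XP_code \<noteq> mat c ** code_projector XP_code"
proof
  let ?Q = "code_projector XP_code"
  assume eq: "?Q ** pauli_string logical_Z ** ?Q = mat c ** ?Q"
  have Q: "?Q *v \<psi> = \<psi>" if "\<psi> \<in> XP_code" for \<psi>
    using projector_onto_fixes[OF XP_projector] that by blast
  have "c = (-1) ^ of_bool t" for t
  proof -
    have "(-1) ^ of_bool t *s logical t = ?Q *v (pauli_string logical_Z *v (?Q *v logical t))"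
      using Q[OF logical_in_XP_code] Q[OF vec.subspace_scale[OF subspace_XP_code logical_in_XP_code]]
      by (simp only: logical_Z_mult)
    also have "\<dots> = mat c *v logical t"
      unfolding matrix_vector_mul_assoc matrix_mul_assoc eq
      by (simp add: Q[OF logical_in_XP_code] flip: matrix_vector_mul_assoc)
    finally have "((-1) ^ of_bool t *s logical t) $ (\<lambda>_. t) = (mat c *v logical t) $ (\<lambda>_. t)"
      by simp
    then show ?thesis
      by (simp add: logical_const matrix_vector_mult_def mat_def if_distrib if_distribR cong: if_cong)
  qed
  from this[of True] this[of False] show False by simp
qed

lemma code_distance_XP_code: "code_distance XP_code = 3"
  unfolding code_distance_def Let_def
proof (rule Least_equality)
  show "\<exists>E. pauli_weight E = 3 \<and> \<not> (\<exists>c. code_projector XP_code ** pauli_string E ** code_projector XP_code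
      = mat c ** code_projector XP_code)"
    using pauli_weight_logical_Z logical_Z_undetected by blast
next
  fix w
  assume "\<exists>E. pauli_weight E = w \<and> \<not> (\<exists>c. code_projector XP_code ** pauli_string E ** code_projector XP_code
      = mat c ** code_projector XP_code)"
  then show "3 \<le> w"
    using light_error_detected not_le by blast
qed

section \<open>Local-unitary inequivalence\<close>

text \<open>The positions 2, 5, 7 support a Hamming word of weight 3, and the remaining 1, 3, 4, 6
  support the sum of the first and third check rows.\<close>

definition line_word :: "bool \<Rightarrow> bool \<Rightarrow> 7 \<Rightarrow> bool" where
  "line_word t s i = (if i \<in> {2, 5, 7} then t else s)"

text \<open>Each check contains exactly two of the positions 2, 5, 7. These cancel, leaving bits 1
  and 3, 3 and 6, 4 and 6 equal.\<close>

lemma hamming_line: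
  assumes "hamming e" "\<And>i. i \<in> {2, 5, 7} \<Longrightarrow> e i = t"
  shows "e = line_word t False \<or> e = line_word t True"
proof -
  have "e 2 = t" "e 5 = t" "e 7 = t" using assms(2) by auto
  then show ?thesis
    using assms(1) unfolding hamming_def fun_eq_iff forall_7 line_word_def
    by (cases t; cases "e 1"; cases "e 3"; cases "e 4"; cases "e 6") simp_all
qed

text \<open>The identity factors force the input word to equal \<open>t\<close> on 2, 5, 7, and only
  two Hamming words do.\<close>

lemma local_op_on_XP_code:
  assumes id: "\<And>i. i \<in> {2, 5, 7} \<Longrightarrow> A i = mat 1" and \<psi>: "\<psi> \<in> XP_code"
    and e: "\<And>i. i \<in> {2, 5, 7} \<Longrightarrow> e i = t"
  shows "(tensor_op A *v \<psi>) $ e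
    = tensor_op A $ e $ line_word t False * \<psi> $ line_word t False
    + tensor_op A $ e $ line_word t True * \<psi> $ line_word t True"
proof -
  let ?S = "{line_word t False, line_word t True}"
  have "tensor_op A $ e $ g * \<psi> $ g = 0" if "g \<notin> ?S" for g
  proof (cases "hamming g")
    case True
    have "\<exists>i\<in>{2, 5, 7}. g i \<noteq> t"
    proof (rule ccontr)
      assume "\<not> ?thesis"
      then have "g \<in> ?S" using hamming_line[OF True, of t] by auto
      with that show False by contradiction
    qed
    then obtain i where i: "i \<in> {2, 5, 7}" "g i \<noteq> t" by blast
    then have "A i $ e i $ g i = 0"
      using id[OF i(1)] e[OF i(1)] by (simp add: mat_def)
    then have "tensor_op A $ e $ g = 0"
      unfolding tensor_op_def vec_lambda_beta by (auto intro!: prod_zero)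
    then show ?thesis by simp
  next
    case False
    then show ?thesis using XP_code_support[OF \<psi>] by auto
  qed
  then have "(\<Sum>g\<in>UNIV. tensor_op A $ e $ g * \<psi> $ g) = (\<Sum>g\<in>?S. tensor_op A $ e $ g * \<psi> $ g)"
    by (intro sum.mono_neutral_right) auto
  moreover have "line_word t False 1 \<noteq> line_word t True 1"
    by (simp add: line_word_def)
  then have "line_word t False \<noteq> line_word t True" by metis
  ultimately show ?thesis
    by (simp add: matrix_vector_mult_def)
qed

lemma local_stabilizer_triangular:
  assumes id: "\<And>i. i \<in> {2, 5, 7} \<Longrightarrow> A i = mat 1"
    and stab: "\<And>\<psi>. \<psi> \<in> XP_code \<Longrightarrow> tensor_op A *v \<psi> = \<psi>"
  shows "A 1 $ False $ False \<noteq> 0" "A 1 $ True $ False = 0"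
proof -
  define \<phi> where "\<phi> = logical False + logical True"
  have \<phi>: "\<phi> \<in> XP_code"
    unfolding \<phi>_def by (intro vec.subspace_add subspace_XP_code logical_in_XP_code)
  \<comment> \<open>These are the entries of the operator on qubits 1, 3, 4, 6 from the inputs 0000
    and 1111 to the output \<open>s000\<close>. They do not depend on \<open>t\<close>, so both
    values of \<open>t\<close> give equations in the same unknowns.\<close>
  define q where "q s = A 1 $ s $ False * A 3 $ False $ False * A 4 $ False $ False * A 6 $ False $ False" for s
  define r where "r s = A 1 $ s $ True * A 3 $ False $ True * A 4 $ False $ True * A 6 $ False $ True" for s
  have A: "A 2 = mat 1" "A 5 = mat 1" "A 7 = mat 1" using id by auto
  have eqs: "tensor_op A $ (line_word t False)(1 := s) $ line_word t False = q s"
    "tensor_op A $ (line_word t False)(1 := s) $ line_word t True = r s" for s t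
    unfolding tensor_op_def vec_lambda_beta prod_7 q_def r_def A
    by (simp_all add: line_word_def mat_def)
  have *: "\<phi> $ (line_word t False)(1 := s) = q s * \<phi> $ line_word t False + r s * \<phi> $ line_word t True" for s t
  proof -
    have "((line_word t False)(1 := s)) i = t" if "i \<in> {2, 5, 7}" for i
      using that by (auto simp: line_word_def)
    then show ?thesis
      using local_op_on_XP_code[of A, OF id \<phi>] stab[OF \<phi>] eqs by metis
  qed
  have id1: "(line_word t False)(1 := False) = line_word t False" for t
    by (simp add: line_word_def fun_eq_iff)
  have \<phi>_nth: "\<phi> $ line_word False False = 1" "\<phi> $ line_word False True = omega"
    "\<phi> $ line_word True False = omega ^ 7" "\<phi> $ line_word True True = 1"
    "\<phi> $ (line_word t False)(1 := True) = 0" for t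
    by (simp_all add: \<phi>_def logical_def hamming_def odd_parity_def word_phase_def line_word_def)
  have "q False + r False * omega = 1" "q False * omega ^ 7 + r False = omega ^ 7"
    "q True + r True * omega = 0" "q True * omega ^ 7 + r True = 0"
    using *[of False False] *[of True False] *[of False True] *[of True True]
    unfolding id1 \<phi>_nth by simp_all
  \<comment> \<open>The relative phases are \<^term>\<open>omega\<close> and \<open>- omega\<close>.\<close>
  moreover have "omega ^ 7 * omega = -1"
    using omega_power_8 by (simp add: numeral_eq_Suc mult_ac)
  ultimately have "q False = 1" "q True = 0"
    by algebra+
  \<comment> \<open>\<open>q False\<close> and \<open>q True\<close> share their factors on qubits
    3, 4, 6, which are nonzero because \<open>q False = 1\<close>.\<close>
  then show "A 1 $ False $ False \<noteq> 0" "A 1 $ True $ False = 0"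
    by (auto simp: q_def)
qed

lemma not_LU_equivalent: "\<not> LU_equivalent XP_code Steane_code"
proof
  assume "LU_equivalent XP_code Steane_code"
  then obtain U where U: "\<And>i. unitary (U i)"
    and eq: "code_projector Steane_code = tensor_op U ** code_projector XP_code ** dagger (tensor_op U)"
    unfolding LU_equivalent_def by blast
  have UU: "dagger (tensor_op U) ** tensor_op U = mat 1"
    using unitary_tensor_op[of U] U by (simp add: unitary_def)
  have Steane: "tensor_op U *v \<psi> \<in> Steane_code" if "\<psi> \<in> XP_code" for \<psi>
  proof -
    have "code_projector Steane_code *v (tensor_op U *v \<psi>)
        = tensor_op U *v (code_projector XP_code *v ((dagger (tensor_op U) ** tensor_op U) *v \<psi>))"
      unfolding eq by (simp add: matrix_vector_mul_assoc matrix_mul_assoc)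
    also have "\<dots> = tensor_op U *v \<psi>"
      using projector_onto_fixes[OF XP_projector] that by (simp add: UU)
    finally show ?thesis
      using projector_onto_fixes[OF code_projector[OF subspace_stabilized_code]]
      unfolding Steane_code_def by blast
  qed
  \<comment> \<open>The two rows overlap exactly in positions 5 and 7, where the Pauli factor
    squares to the identity. So \<open>L p\<close> is \<open>p\<close> on qubits 1, 3, 4, 6 and
    trivial on 2, 5, 7.\<close>
  let ?h = "vector [1,0,1,0,1,0,1] :: nat ^ 7" and ?k = "vector [0,0,0,1,1,1,1] :: nat ^ 7"
  define L where "L p i = mat_pow (pauli_mat p) (?h $ i) ** mat_pow (pauli_mat p) (?k $ i)" for p i
  define A where "A p = (\<lambda>i. dagger (U i) ** (L p i ** U i))" for p
  have A_fixes: "tensor_op (A p) *v \<psi> = \<psi>" if "\<psi> \<in> XP_code" "p \<in> {PauliX, PauliZ}" for p \<psi>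
  proof -
    have "g *v (tensor_op U *v \<psi>) = tensor_op U *v \<psi>" if "g \<in> Steane_generators" for g
      using Steane[OF \<open>\<psi> \<in> XP_code\<close>] generate.incl[OF that]
      unfolding Steane_code_def stabilized_code_def by blast
    moreover have "pauli_power p ?h \<in> Steane_generators" "pauli_power p ?k \<in> Steane_generators"
      using that(2) by (auto simp: Steane_generators_def)
    moreover have "tensor_op (A p) = dagger (tensor_op U) ** ((pauli_power p ?h ** pauli_power p ?k) ** tensor_op U)"
      by (simp add: A_def L_def pauli_power_def tensor_op_mult dagger_tensor_op)
    ultimately have "tensor_op (A p) *v \<psi> = (dagger (tensor_op U) ** tensor_op U) *v \<psi>"
      by (simp add: flip: matrix_vector_mul_assoc)
    then show ?thesis by (simp add: UU)
  qed
  have sq: "pauli_mat p ** pauli_mat p = mat 1" if "p \<in> {PauliX, PauliZ}" for p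
    using that by (auto simp: vec_eq_iff matrix_matrix_mult_def UNIV_bool_sum pauli_mat_nth mat_def simp del: pauli_mat.simps)
  have "L p i = mat 1" if "p \<in> {PauliX, PauliZ}" "i \<in> {2, 5, 7}" for p i
    using that(2) sq[OF that(1)] by (auto simp: L_def vector_7)
  then have A_id: "A p i = mat 1" if "p \<in> {PauliX, PauliZ}" "i \<in> {2, 5, 7}" for p i
    using that U by (simp add: A_def unitary_def)
  have tri: "A p 1 $ False $ False \<noteq> 0" "A p 1 $ True $ False = 0" if "p \<in> {PauliX, PauliZ}" for p
    using local_stabilizer_triangular[of "A p"] A_id[OF that] A_fixes[OF _ that] by blast+
  have L1: "L p 1 = pauli_mat p" for p
    by (simp add: L_def vector_7)
  have "A p 1 ** A p' 1 = dagger (U 1) ** (pauli_mat p ** pauli_mat p') ** U 1" for p p'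
  proof -
    have "A p 1 ** A p' 1 = dagger (U 1) ** pauli_mat p ** (U 1 ** dagger (U 1)) ** pauli_mat p' ** U 1"
      by (simp only: A_def L1 matrix_mul_assoc)
    also have "U 1 ** dagger (U 1) = mat 1"
      using U by (simp add: unitary_def)
    finally show ?thesis by (simp only: matrix_mul_rid matrix_mul_assoc)
  qed
  moreover have "pauli_mat PauliX ** pauli_mat PauliZ = mat (-1) ** (pauli_mat PauliZ ** pauli_mat PauliX)"
    by (simp add: vec_eq_iff del: pauli_mat.simps)
      (simp add: matrix_matrix_mult_def UNIV_bool_sum pauli_mat_nth del: pauli_mat.simps)
  moreover have "dagger (U 1) ** (mat (-1) ** B) ** U 1 = mat (-1) ** (dagger (U 1) ** B ** U 1)" for B
    by (simp add: vec_eq_iff) (simp add: matrix_matrix_mult_def UNIV_bool_sum mat_def algebra_simps)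
  ultimately have "A PauliX 1 ** A PauliZ 1 = mat (-1) ** (A PauliZ 1 ** A PauliX 1)"
    by simp
  then have "(A PauliX 1 ** A PauliZ 1) $ False $ False = - (A PauliZ 1 ** A PauliX 1) $ False $ False"
    by simp
  \<comment> \<open>For upper triangular factors the top left entry of a product is the product of
    the top left entries in either order, so here it equals its own negative.\<close>
  then have "A PauliX 1 $ False $ False * A PauliZ 1 $ False $ False = 0"
    using tri by (simp add: matrix_matrix_mult_def UNIV_bool_sum)
  then show False using tri by auto
qed

theorem mainTheorem4:
  shows "vec.dim XP_code = 2 \<and> code_distance XP_code = 3 \<and>
    \<not> LU_equivalent XP_code Steane_code"
  using dim_XP_code code_distance_XP_code not_LU_equivalent by blast

end
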